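(* Let $\{S(t)\}_{t\ge0}$ be a twin semigroup on a norming dual pair $(Y,Y^\diamond)$ and assume that $(Y,\sigma(Y,Y^\diamond))$ is sequentially complete. Let $q\in Y$. For $y^\diamond\in Y^\diamond$ define $y^\diamond W(\sigma)=0$ for $\sigma=0$ and $y^\diamond W(\sigma)=y^\diamond S(\sigma)q$ for $\sigma>0$. Assume that for all $y^\diamond\in Y^\diamond$ the function $\sigma\mapsto y^\diamond W(\sigma)$ belongs to $NBV_{loc}([0,\infty);\mathbb R)$. Let $F:[0,\infty)\to\mathbb R$ be locally bounded and measurable. Then, for each $t>0$, there exists $u(t)\in Y$ such that for all $y^\diamond\in Y^\diamond$ $$\int_{[0,t]}d_\sigma\bigl[y^\diamond W(\sigma)\bigr]\,F(t-\sigma)=\langle y^\diamond,u(t)\rangle .$$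
   Context: Banach spaces $Y,Y^\diamond$ (real) form a norming dual pair if there is a bilinear map $\langle\cdot,\cdot\rangle:Y^\diamond\times Y\to\mathbb R$ with $|\langle y^\diamond,y\rangle|\le M\|y^\diamond\|\|y\|$ for some $M\ge1$, $\|y\|=\sup\{|\langle y^\diamond,y\rangle|:\|y^\diamond\|\le1\}$ and $\|y^\diamond\|=\sup\{|\langle y^\diamond,y\rangle|:\|y\|\le1\}$. $\sigma(Y,Y^\diamond)$ is the weak topology on $Y$ induced by $Y^\diamond$. A twin operator $L$ is a bounded bilinear map $Y^\diamond\times Y\to\mathbb R$, $(y^\diamond,y)\mapsto y^\diamond Ly$, such that for each $y$ there is $Ly\in Y$ with $\langle y^\diamond,Ly\rangle=y^\diamond Ly$ for all $y^\diamond$, and for each $y^\diamond$ there is $y^\diamond L\in Y^\diamond$ with $\langle y^\diamond L,y\rangle=y^\diamond Ly$ for all $y$. Composition: $y^\diamond L_1L_2y:=\langle y^\diamond L_1,L_2y\rangle$. A twin semigroup is a family $\{S(t)\}_{t\ge0}$ of twin operators with: (i) $S(0)=I$, $S(t+s)=S(t)S(s)$; (ii) $|y^\diamond S(t)y|\le Me^{\omega t}\|y\|\|y^\diamond\|$ for some $M\ge1,\omega\in\mathbb R$; (iii) $t\mapsto y^\diamond S(t)y$ is measurable for all $y,y^\diamond$; (iv) for $\operatorname{Re}\lambda>\omega$ there is a twin operator $\overline S(\lambda)$ (on the complexification if $\lambda$ is non-real) with $y^\diamond\overline S(\lambda)y=\int_0^\infty e^{-\lambda t}y^\diamond S(t)y\,dt$.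 Measurable means Borel measurable. $NBV_{loc}([0,\infty))$: functions $G$ of locally bounded variation with $G(0)=0$, right-continuous on $(0,\infty)$; $dG$ is the Radon measure on $[0,\infty)$ with $dG([0,t])=G(t)$ for $t>0$ (so it has mass $G(0+)$ at $0$). *)

theory Defs
  imports "HOL-Analysis.Analysis"
begin

section \<open>Norming dual pairs\<close>

text \<open>
  The type \<open>'d\<close> stands for the Banach space \<open>Y\<^sup>\<diamond>\<close>, the type \<open>'y\<close> for \<open>Y\<close>, and \<open>B d y\<close> for the
  pairing of \<open>d\<close> and \<open>y\<close>.
\<close>

definition norming_dual_pair :: "('d::banach \<Rightarrow> 'y::banach \<Rightarrow> real) \<Rightarrow> bool" where
  "norming_dual_pair B \<longleftrightarrow>
     bilinear B \<and>
     (\<exists>M\<ge>1. \<forall>d y. \<bar>B d y\<bar> \<le> M * norm d * norm y) \<and>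
     (\<forall>y. norm y = (SUP d\<in>{d. norm d \<le> 1}. \<bar>B d y\<bar>)) \<and>
     (\<forall>d. norm d = (SUP y\<in>{y. norm y \<le> 1}. \<bar>B d y\<bar>))"

definition weak_topology :: "('d::banach \<Rightarrow> 'y::banach \<Rightarrow> real) \<Rightarrow> 'y topology" where
  "weak_topology B = topology_generated_by {B d -` U | d U. open U}"

text \<open>The Cauchy condition is that of the translation-invariant uniformity of a topological vector space.\<close>

definition weakly_Cauchy :: "('d::banach \<Rightarrow> 'y::banach \<Rightarrow> real) \<Rightarrow> (nat \<Rightarrow> 'y) \<Rightarrow> bool" where
  "weakly_Cauchy B X \<longleftrightarrow>
     (\<forall>U. openin (weak_topology B) U \<and> 0 \<in> U \<longrightarrow>
        (\<exists>N. \<forall>m\<ge>N. \<forall>n\<ge>N. X m - X n \<in> U))"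

definition weakly_sequentially_complete :: "('d::banach \<Rightarrow> 'y::banach \<Rightarrow> real) \<Rightarrow> bool" where
  "weakly_sequentially_complete B \<longleftrightarrow>
     (\<forall>X. weakly_Cauchy B X \<longrightarrow> (\<exists>l. limitin (weak_topology B) X l sequentially))"


section \<open>Twin operators\<close>

definition twin_operator ::
    "('d::banach \<Rightarrow> 'y::banach \<Rightarrow> real) \<Rightarrow> ('d \<Rightarrow> 'y \<Rightarrow> real) \<Rightarrow> bool" where
  "twin_operator B L \<longleftrightarrow>
     bounded_bilinear L \<and>
     (\<forall>y. \<exists>z. \<forall>d. B d z = L d y) \<and>
     (\<forall>d. \<exists>e. \<forall>y. B e y = L d y)"

text \<open>
  The operators \<open>y \<mapsto> L y\<close> and \<open>d \<mapsto> d L\<close> determined by a twin operator; the representing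
  elements are unique because the pairing separates points.
\<close>

definition twin_right ::
    "('d::banach \<Rightarrow> 'y::banach \<Rightarrow> real) \<Rightarrow> ('d \<Rightarrow> 'y \<Rightarrow> real) \<Rightarrow> 'y \<Rightarrow> 'y" where
  "twin_right B L y = (THE z. \<forall>d. B d z = L d y)"

definition twin_left ::
    "('d::banach \<Rightarrow> 'y::banach \<Rightarrow> real) \<Rightarrow> ('d \<Rightarrow> 'y \<Rightarrow> real) \<Rightarrow> 'd \<Rightarrow> 'd" where
  "twin_left B L d = (THE e. \<forall>y. B e y = L d y)"

definition twin_comp ::
    "('d::banach \<Rightarrow> 'y::banach \<Rightarrow> real) \<Rightarrow> ('d \<Rightarrow> 'y \<Rightarrow> real) \<Rightarrow> ('d \<Rightarrow> 'y \<Rightarrow> real) \<Rightarrow> 'd \<Rightarrow> 'y \<Rightarrow> real"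
  where
  "twin_comp B L1 L2 d y = B (twin_left B L1 d) (twin_right B L2 y)"


section \<open>Complexification\<close>

text \<open>
  The pair \<open>(x, y)\<close> represents \<open>x + i y\<close>. The product norm is not complex homogeneous, but it is
  equivalent to the usual complexification norms, so it yields the same bounded bilinear maps.
\<close>

definition cplx_scale :: "complex \<Rightarrow> 'a::real_vector \<times> 'a \<Rightarrow> 'a \<times> 'a" where
  "cplx_scale c v =
     (Re c *\<^sub>R fst v - Im c *\<^sub>R snd v, Re c *\<^sub>R snd v + Im c *\<^sub>R fst v)"

text \<open>The complex-bilinear extension of a real-bilinear form.\<close>

definition cplx_form :: "('d \<Rightarrow> 'y \<Rightarrow> real) \<Rightarrow> 'd \<times> 'd \<Rightarrow> 'y \<times> 'y \<Rightarrow> complex" where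
  "cplx_form L d y =
     Complex (L (fst d) (fst y) - L (snd d) (snd y)) (L (fst d) (snd y) + L (snd d) (fst y))"

definition cplx_twin_operator ::
    "('d::banach \<Rightarrow> 'y::banach \<Rightarrow> real) \<Rightarrow> ('d \<times> 'd \<Rightarrow> 'y \<times> 'y \<Rightarrow> complex) \<Rightarrow> bool" where
  "cplx_twin_operator B L \<longleftrightarrow>
     bounded_bilinear L \<and>
     (\<forall>c d y. L (cplx_scale c d) y = c * L d y \<and> L d (cplx_scale c y) = c * L d y) \<and>
     (\<forall>y. \<exists>z. \<forall>d. cplx_form B d z = L d y) \<and>
     (\<forall>d. \<exists>e. \<forall>y. cplx_form B e y = L d y)"


section \<open>Twin semigroups\<close>

text \<open>
  Only the values \<open>S t\<close> with \<open>t \<ge> 0\<close> matter. The identity twin operator is the pairing \<open>B\<close> itself.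
\<close>

definition twin_semigroup ::
    "('d::banach \<Rightarrow> 'y::banach \<Rightarrow> real) \<Rightarrow> (real \<Rightarrow> 'd \<Rightarrow> 'y \<Rightarrow> real) \<Rightarrow> bool" where
  "twin_semigroup B S \<longleftrightarrow>
     (\<forall>t\<ge>0. twin_operator B (S t)) \<and>
     S 0 = B \<and>
     (\<forall>t\<ge>0. \<forall>s\<ge>0. S (t + s) = twin_comp B (S t) (S s)) \<and>
     (\<forall>d y. (\<lambda>t. S t d y) \<in> borel_measurable (restrict_space borel {0..})) \<and>
     (\<exists>M\<ge>1. \<exists>\<omega>::real.
        (\<forall>t\<ge>0. \<forall>d y. \<bar>S t d y\<bar> \<le> M * exp (\<omega> * t) * norm y * norm d) \<and>
        (\<forall>r::real. r > \<omega> \<longrightarrow>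
           (\<exists>R. twin_operator B R \<and>
                (\<forall>d y. R d y = (LINT t:{0..}|lborel. exp (- r * t) * S t d y)))) \<and>
        (\<forall>z::complex. Re z > \<omega> \<and> z \<notin> \<real> \<longrightarrow>
           (\<exists>R. cplx_twin_operator B R \<and>
                (\<forall>d y. R d y =
                   (LINT t:{0..}|lborel. exp (- z * complex_of_real t) * cplx_form (S t) d y)))))"


section \<open>Functions of bounded variation and their measures\<close>

definition bounded_variation_on :: "real \<Rightarrow> real \<Rightarrow> (real \<Rightarrow> real) \<Rightarrow> bool" where
  "bounded_variation_on a b G \<longleftrightarrow>
     (\<exists>K. \<forall>n (x :: nat \<Rightarrow> real).
        (\<forall>i\<le>n. x i \<in> {a..b}) \<and> (\<forall>i<n. x i \<le> x (Suc i)) \<longrightarrow>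
        (\<Sum>i<n. \<bar>G (x (Suc i)) - G (x i)\<bar>) \<le> K)"

definition NBV_loc :: "(real \<Rightarrow> real) set" where
  "NBV_loc = {G. G 0 = 0 \<and> (\<forall>x>0. continuous (at_right x) G) \<and>
                 (\<forall>T\<ge>0. bounded_variation_on 0 T G)}"

definition radon_measure_halfline :: "real measure \<Rightarrow> bool" where
  "radon_measure_halfline P \<longleftrightarrow>
     sets P = sets (restrict_space borel {0..}) \<and> (\<forall>T. emeasure P {0..T} < \<infinity>)"

text \<open>
  The measure \<open>dG\<close> is a signed Radon measure on the half-line, possibly of infinite total variation.
  It is represented by a difference of two positive Radon measures \<open>P\<close> and \<open>N\<close>, not necessarily
  the mutually singular ones: \<open>dG A = P A - N A\<close> for bounded Borel sets \<open>A\<close>.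
\<close>

definition represents_dG :: "(real \<Rightarrow> real) \<Rightarrow> real measure \<Rightarrow> real measure \<Rightarrow> bool" where
  "represents_dG G P N \<longleftrightarrow>
     radon_measure_halfline P \<and> radon_measure_halfline N \<and>
     (\<forall>t>0. measure P {0..t} - measure N {0..t} = G t)"

text \<open>
  The integral of \<open>f\<close> over a bounded Borel set \<open>A\<close> with respect to \<open>dG\<close>. If \<open>(P, N)\<close> and
  \<open>(P', N')\<close> both represent \<open>dG\<close>, then \<open>P + N' = P' + N\<close>, so the value does not depend on the
  representing pair.
\<close>

definition dG_integral :: "(real \<Rightarrow> real) \<Rightarrow> real set \<Rightarrow> (real \<Rightarrow> real) \<Rightarrow> real" where
  "dG_integral G A f =
     (THE I. \<exists>P N. represents_dG G P N \<and> set_integrable P A f \<and> set_integrable N A f \<and>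
                   I = (LINT x:A|P. f x) - (LINT x:A|N. f x))"

definition orbit_from_zero ::
    "(real \<Rightarrow> 'd::banach \<Rightarrow> 'y::banach \<Rightarrow> real) \<Rightarrow> 'y \<Rightarrow> 'd \<Rightarrow> real \<Rightarrow> real" where
  "orbit_from_zero S q d \<sigma> = (if \<sigma> = 0 then 0 else S \<sigma> d q)"

end

theory Submission
  imports Defs
begin

text \<open>
  For \<open>d \<in> Y\<^sup>\<diamond>\<close> let \<open>G d\<close> be the function \<open>\<sigma> \<mapsto> d W(\<sigma>)\<close>. Fix \<open>t > 0\<close> and call a bounded Borel function
  \<open>f\<close> supported in \<open>[0,t]\<close> representable if a single \<open>u \<in> Y\<close> satisfies \<open>\<integral> f d(G d) = \<langle>d, u\<rangle>\<close> for
  all \<open>d\<close> at once. The claim is that \<open>\<sigma> \<mapsto> F (t - \<sigma>)\<close> is representable, and this is a monotone class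
  argument.

  The indicator of \<open>[0,s]\<close> with \<open>0 < s \<le> t\<close> is representable by the element \<open>S(s) q\<close>, because
  \<open>d(G d)([0,s]) = G d s\<close>.
  Representable functions form a vector space. They are closed under pointwise limits of uniformly bounded sequences: by
  dominated convergence the integrals converge for each \<open>d\<close>, so the representing elements form a
  Cauchy sequence for \<open>\<sigma>(Y, Y\<^sup>\<diamond>)\<close>, and sequential completeness provides the element that represents
  the limit (\<open>weakly_sequentially_complete_limit\<close>). A class with these three closure properties contains
  every bounded Borel function on \<open>[0,t]\<close> (\<open>bounded_borel_on_induct\<close>).

  The measures must be shown to exist and to give an unambiguous integral. Existence is the Jordan
  decomposition of a function of bounded variation (\<open>NBV_loc_represented\<close>). Independence of the chosen
  pair of positive measures (\<open>difference_integral_unique\<close>) is again an instance of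
  \<open>bounded_borel_on_induct\<close>, since two pairs that represent \<open>dG\<close> agree on the intervals \<open>[0,s]\<close>.
\<close>

section \<open>Bounded Borel functions on a compact interval\<close>

text \<open>
  Functions on \<open>A\<close> are extended by zero to the whole line, so that measurability and
  integration need no restriction.
\<close>

definition bounded_borel_on :: "real set \<Rightarrow> (real \<Rightarrow> real) \<Rightarrow> bool" where
  "bounded_borel_on A f \<longleftrightarrow>
     f \<in> borel_measurable borel \<and> (\<exists>K. \<forall>x. \<bar>f x\<bar> \<le> K * indicator A x)"

lemma bounded_borel_onI:
  assumes "f \<in> borel_measurable borel" "\<And>x. \<bar>f x\<bar> \<le> K * indicator A x"
  shows "bounded_borel_on A f"
  using assms by (auto simp: bounded_borel_on_def)

lemma bounded_borel_on_indicator: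
  assumes "X \<in> sets borel" "X \<subseteq> A"
  shows "bounded_borel_on A (indicator X)"
  by (rule bounded_borel_onI[where K = 1]) (use assms in \<open>auto simp: indicator_def\<close>)

lemma bounded_borel_on_scale:
  assumes "bounded_borel_on A f"
  shows "bounded_borel_on A (\<lambda>x. c * f x)"
proof -
  obtain K where K: "\<And>x. \<bar>f x\<bar> \<le> K * indicator A x" and [measurable]: "f \<in> borel_measurable borel"
    using assms by (auto simp: bounded_borel_on_def)
  show ?thesis
  proof (rule bounded_borel_onI)
    show "\<bar>c * f x\<bar> \<le> (\<bar>c\<bar> * K) * indicator A x" for x
      using mult_left_mono[OF K[of x], of "\<bar>c\<bar>"] by (simp add: abs_mult mult.assoc)
  qed measurable
qed

lemma bounded_borel_on_add:
  assumes "bounded_borel_on A f" "bounded_borel_on A g"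
  shows "bounded_borel_on A (\<lambda>x. f x + g x)"
proof -
  obtain K K' where K: "\<And>x. \<bar>f x\<bar> \<le> K * indicator A x" "\<And>x. \<bar>g x\<bar> \<le> K' * indicator A x"
    and [measurable]: "f \<in> borel_measurable borel" "g \<in> borel_measurable borel"
    using assms by (auto simp: bounded_borel_on_def)
  show ?thesis
  proof (rule bounded_borel_onI)
    show "\<bar>f x + g x\<bar> \<le> (K + K') * indicator A x" for x
      using K[of x] by (simp add: distrib_right)
  qed measurable
qed

text \<open>
  Monotone class theorem. The generators are the intervals \<open>[0,s]\<close> with \<open>s > 0\<close> because a function \<open>G\<close>
  prescribes the measure \<open>dG\<close> on exactly these; the limit rule recovers the indicator of \<open>{0}\<close>
  from them. They then give a Dynkin system that contains the half-lines, hence all Borel sets, and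
  approximation by simple functions leads from sets to functions.
\<close>

lemma bounded_borel_on_induct [consumes 2, case_names initial scale add limit]:
  fixes Q :: "(real \<Rightarrow> real) \<Rightarrow> bool"
  assumes f: "bounded_borel_on {0..t} f" and t: "0 < t"
    and initial: "\<And>s. 0 < s \<Longrightarrow> s \<le> t \<Longrightarrow> Q (indicator {0..s})"
    and scale: "\<And>c g. bounded_borel_on {0..t} g \<Longrightarrow> Q g \<Longrightarrow> Q (\<lambda>x. c * g x)"
    and add: "\<And>g h. bounded_borel_on {0..t} g \<Longrightarrow> bounded_borel_on {0..t} h \<Longrightarrow>
                Q g \<Longrightarrow> Q h \<Longrightarrow> Q (\<lambda>x. g x + h x)"
    and limit: "\<And>g h K. (\<And>n. g n \<in> borel_measurable borel) \<Longrightarrow>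
                (\<And>n x. \<bar>g n x\<bar> \<le> K * indicator {0..t} x) \<Longrightarrow> (\<And>n::nat. Q (g n)) \<Longrightarrow>
                (\<And>x. (\<lambda>n. g n x) \<longlonglongrightarrow> h x) \<Longrightarrow> Q h"
  shows "Q f"
proof -
  have full: "Q (indicator {0..t})" using initial[of t] t by simp
  have zero: "Q (\<lambda>x. 0)"
    using scale[OF bounded_borel_on_indicator full, of 0] by simp
  have sets: "Q (indicator ({0..t} \<inter> X))" if "X \<in> sets borel" for X
  proof -
    have stable: "Int_stable (range (atMost :: real \<Rightarrow> _))"
      by (auto simp: Int_stable_def image_iff intro!: exI[of _ "min _ _"])
    have subsets: "range (atMost :: real \<Rightarrow> _) \<subseteq> Pow UNIV" by simp
    have "X \<in> sigma_sets UNIV (range atMost)"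
      using that by (simp add: borel_eq_atMost)
    from stable subsets this show ?thesis
    proof (induction X rule: sigma_sets_induct_disjoint)
      case (basic X)
      then obtain a where X: "X = {..a}" by auto
      consider "a < 0" | "a = 0" | "0 < a" by linarith
      then show ?case
      proof cases
        case 1
        then have "{0..t} \<inter> X = {}" using X by auto
        then show ?thesis using zero by simp
      next
        case 2
        then have eq: "{0..t} \<inter> X = {0}" using X t by auto
        have "Q (indicator {0})"
        proof (rule limit[where g = "\<lambda>n. indicator {0..t / Suc n}" and K = 1])
          show "\<bar>indicator {0..t / real (Suc n)} x\<bar> \<le> 1 * (indicator {0..t} x :: real)" for n x
          proof -
            have "t / real (Suc n) \<le> t" using t by (simp add: divide_le_eq)
            then show ?thesis by (auto simp: indicator_def)
          qed
          show "Q (indicator {0..t / real (Suc n)})" for n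
            using t by (intro initial) (auto simp: divide_le_eq)
          show "(\<lambda>n. indicator {0..t / real (Suc n)} x) \<longlonglongrightarrow> (indicator {0} x :: real)" for x
          proof (cases "0 < x")
            case True
            have "(\<lambda>n. t / real (Suc n)) \<longlonglongrightarrow> 0"
              using LIMSEQ_inverse_real_of_nat tendsto_mult_right_zero[of _ sequentially t]
              by (auto simp: divide_inverse)
            from order_tendstoD(2)[OF this True]
            have "\<forall>\<^sub>F n in sequentially. indicator {0..t / real (Suc n)} x = (indicator {0} x :: real)"
              by eventually_elim (use True in \<open>auto simp: indicator_def\<close>)
            then show ?thesis by (rule tendsto_eventually)
          qed (use t in \<open>auto simp: indicator_def\<close>)
        qed auto
        then show ?thesis using eq by simp
      next
        case 3
        then have "{0..t} \<inter> X = {0..min a t}" using X by auto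
        then show ?thesis using initial[of "min a t"] 3 t by simp
      qed
    next
      case empty
      then show ?case using zero by simp
    next
      case (compl X)
      then have X: "X \<in> sets borel" by (simp add: borel_eq_atMost)
      let ?i = "indicator ({0..t} \<inter> X) :: real \<Rightarrow> real"
      have b: "bounded_borel_on {0..t} ?i"
        using X by (intro bounded_borel_on_indicator) auto
      have "Q (\<lambda>x. indicator {0..t} x + (-1) * ?i x)"
        by (intro add scale full compl b bounded_borel_on_scale bounded_borel_on_indicator) auto
      also have "(\<lambda>x. indicator {0..t} x + (-1) * ?i x) = indicator ({0..t} \<inter> (UNIV - X))"
        by (auto simp: indicator_def)
      finally show ?case .
    next
      case (union X)
      have X[measurable]: "X n \<in> sets borel" for n
        using union(2) by (auto simp: borel_eq_atMost)
      let ?s = "\<lambda>n. indicator ({0..t} \<inter> (\<Union>i<n. X i)) :: real \<Rightarrow> real"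
      show ?case
      proof (rule limit[where g = ?s and K = 1])
        show "Q (?s n)" for n
        proof (induction n)
          case 0
          then show ?case using zero by simp
        next
          case (Suc n)
          have disj: "x \<notin> X i" if "x \<in> X n" "i < n" for x i
            using disjoint_family_onD[OF union(1), of i n] that by auto
          have "Q (\<lambda>x. ?s n x + indicator ({0..t} \<inter> X n) x)"
            by (intro add Suc union bounded_borel_on_indicator) auto
          also have "(\<lambda>x. ?s n x + indicator ({0..t} \<inter> X n) x) = ?s (Suc n)"
            using disj by (auto simp: fun_eq_iff indicator_def less_Suc_eq)
          finally show ?case .
        qed
        show "(\<lambda>n. ?s n x) \<longlonglongrightarrow> indicator ({0..t} \<inter> (\<Union>i. X i)) x" for x
        proof (cases "x \<in> {0..t} \<inter> (\<Union>i. X i)")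
          case True
          then obtain m where m: "x \<in> X m" "x \<in> {0..t}" by auto
          have "\<forall>\<^sub>F n in sequentially. ?s n x = indicator ({0..t} \<inter> (\<Union>i. X i)) x"
            using eventually_gt_at_top[of m] by eventually_elim (use m in \<open>auto simp: indicator_def\<close>)
          then show ?thesis by (rule tendsto_eventually)
        qed (auto simp: indicator_def)
      qed (auto simp: indicator_def)
    qed
  qed
  note sum_closed = add
  \<comment> \<open>The bound on \<open>u\<close> is part of the induction claim, since the limit rule needs a common bound for the
      approximating functions; those increase to \<open>u\<close> and inherit its bound.\<close>
  have nonneg: "Q (\<lambda>x. indicator {0..t} x * u x)"
    if u: "u \<in> borel_measurable borel" "\<And>x. 0 \<le> u x" and "\<And>x. u x \<le> K" for u K
    using u that(3)
  proof (induction u arbitrary: K rule: borel_measurable_induct_real)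
    case (set X)
    then show ?case using sets[of X] by (simp add: indicator_inter_arith[abs_def])
  next
    case (mult u c)
    show ?case
    proof (cases "c = 0")
      case False
      then have c: "c > 0" using mult by simp
      then have le: "u x \<le> K / c" for x
        using mult.prems[of x] by (simp add: pos_le_divide_eq mult.commute)
      have "bounded_borel_on {0..t} (\<lambda>x. indicator {0..t} x * u x)"
        by (rule bounded_borel_onI[where K = "K / c"])
          (use mult le in \<open>auto simp: indicator_def\<close>)
      from scale[OF this mult.IH[OF le], of c] show ?thesis
        by (simp add: mult_ac)
    qed (use zero in simp)
  next
    case (add u v)
    have le: "u x \<le> K" "v x \<le> K" for x
      using add.prems[of x] add.hyps(2)[of x] add.hyps(4)[of x] by linarith+
    have "bounded_borel_on {0..t} (\<lambda>x. indicator {0..t} x * u x)"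
      "bounded_borel_on {0..t} (\<lambda>x. indicator {0..t} x * v x)"
      by (rule bounded_borel_onI[where K = K]; use add le in \<open>auto simp: indicator_def\<close>)+
    from sum_closed[OF this(2,1) add.IH(2)[OF le(2)] add.IH(1)[OF le(1)]] show ?case
      by (simp add: distrib_left)
  next
    case (seq U)
    have le: "U n x \<le> K" for n x
    proof -
      have "U n x \<le> u x"
        using seq.hyps(3) seq.hyps(4)[of x]
        by (intro incseq_le) (auto simp: incseq_def le_fun_def)
      then show ?thesis using seq.prems[of x] by linarith
    qed
    show ?case
    proof (rule limit[where g = "\<lambda>n x. indicator {0..t} x * U n x" and K = K])
      show "Q (\<lambda>x. indicator {0..t} x * U n x)" for n
        by (rule seq.IH[OF le])
      show "(\<lambda>n. indicator {0..t} x * U n x) \<longlonglongrightarrow> indicator {0..t} x * u x" for x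
        by (intro tendsto_mult_left seq.hyps(4)) simp
    qed (use seq.hyps le in \<open>auto simp: indicator_def\<close>)
  qed
  obtain K where K: "\<And>x. \<bar>f x\<bar> \<le> K * indicator {0..t} x" and [measurable]: "f \<in> borel_measurable borel"
    using f by (auto simp: bounded_borel_on_def)
  have K1: "f x \<le> \<bar>K\<bar>" "- f x \<le> \<bar>K\<bar>" for x
    using K[of x] by (cases "x \<in> {0..t}"; simp)+
  let ?p = "\<lambda>x. max 0 (f x)" and ?n = "\<lambda>x. max 0 (- f x)"
  have "Q (\<lambda>x. indicator {0..t} x * ?p x + (-1) * (indicator {0..t} x * ?n x))"
  proof (intro add scale)
    show "Q (\<lambda>x. indicator {0..t} x * ?p x)" "Q (\<lambda>x. indicator {0..t} x * ?n x)"
      by (rule nonneg[where K = "\<bar>K\<bar>"]; use K1 in simp)+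
    show p: "bounded_borel_on {0..t} (\<lambda>x. indicator {0..t} x * ?p x)"
      by (rule bounded_borel_onI[where K = "\<bar>K\<bar>"]; use K1 in \<open>simp add: indicator_def\<close>)
    show n: "bounded_borel_on {0..t} (\<lambda>x. indicator {0..t} x * ?n x)"
      by (rule bounded_borel_onI[where K = "\<bar>K\<bar>"]; use K1 in \<open>simp add: indicator_def\<close>)
    show "bounded_borel_on {0..t} (\<lambda>x. (-1) * (indicator {0..t} x * ?n x))"
      by (rule bounded_borel_on_scale[OF n])
  qed
  also have "(\<lambda>x. indicator {0..t} x * ?p x + (-1) * (indicator {0..t} x * ?n x)) = f"
  proof
    fix x
    show "indicator {0..t} x * ?p x + (-1) * (indicator {0..t} x * ?n x) = f x"
      using K[of x] by (cases "x \<in> {0..t}") auto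
  qed
  finally show ?thesis .
qed

section \<open>Integration against a pair of Radon measures\<close>

lemma radon_measurable:
  assumes "radon_measure_halfline P" "f \<in> borel_measurable borel"
  shows "f \<in> borel_measurable P"
proof -
  have "f \<in> borel_measurable (restrict_space borel {0..})"
    using assms(2) by (rule measurable_restrict_space1)
  moreover have "sets P = sets (restrict_space borel {0..})"
    using assms(1) by (simp add: radon_measure_halfline_def)
  ultimately show ?thesis by (simp cong: measurable_cong_sets)
qed

lemma radon_sets_Icc:
  assumes "radon_measure_halfline P"
  shows "{0..t} \<in> sets P"
  using assms by (auto simp: radon_measure_halfline_def sets_restrict_space image_iff
      intro!: bexI[of _ "{0..t}"])

lemma radon_integrable_indicator:
  assumes "radon_measure_halfline P"
  shows "integrable P (\<lambda>x. K * indicator {0..t} x :: real)"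
  using assms radon_sets_Icc[OF assms, of t]
  by (auto simp: radon_measure_halfline_def less_top)

lemma radon_integrable:
  assumes P: "radon_measure_halfline P" and f: "bounded_borel_on {0..t} f"
  shows "integrable P f"
proof -
  obtain K where K: "\<And>x. \<bar>f x\<bar> \<le> K * indicator {0..t} x" and "f \<in> borel_measurable borel"
    using f by (auto simp: bounded_borel_on_def)
  then have "f \<in> borel_measurable P" using radon_measurable[OF P] by blast
  moreover have "norm (f x) \<le> norm (K * indicator {0..t} x)" for x
    using K[of x] by simp
  ultimately show ?thesis
    by (intro Bochner_Integration.integrable_bound[OF radon_integrable_indicator[OF P]]) auto
qed

definition difference_integral :: "real measure \<Rightarrow> real measure \<Rightarrow> (real \<Rightarrow> real) \<Rightarrow> real" where
  "difference_integral P N f = integral\<^sup>L P f - integral\<^sup>L N f"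

lemma difference_integral_scale:
  "difference_integral P N (\<lambda>x. c * f x) = c * difference_integral P N f"
  by (simp add: difference_integral_def right_diff_distrib)

text \<open>
  For \<open>(P, N)\<close> representing \<open>dG\<close> the difference of the integrals has the properties that match the rules of
  \<open>bounded_borel_on_induct\<close>.
\<close>

context
  fixes G P N
  assumes rep: "represents_dG G P N"
begin

lemma represents_radon: "radon_measure_halfline P" "radon_measure_halfline N"
  using rep by (auto simp: represents_dG_def)

lemma difference_integral_initial:
  assumes "0 < s"
  shows "difference_integral P N (indicator {0..s}) = G s"
proof -
  have "{0..s} \<inter> space P = {0..s}" "{0..s} \<inter> space N = {0..s}"
    using represents_radon[THEN radon_sets_Icc, of s] by (auto dest: sets.sets_into_space)
  then show ?thesis
    using assms rep by (simp add: difference_integral_def represents_dG_def)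
qed

lemma difference_integral_add:
  assumes "bounded_borel_on {0..t} f" "bounded_borel_on {0..t} g"
  shows "difference_integral P N (\<lambda>x. f x + g x) =
    difference_integral P N f + difference_integral P N g"
  using represents_radon[THEN radon_integrable, OF assms(1)]
    represents_radon[THEN radon_integrable, OF assms(2)]
  by (simp add: difference_integral_def)

lemma difference_integral_tendsto:
  assumes g: "\<And>n. g n \<in> borel_measurable borel" "\<And>n x. \<bar>g n x\<bar> \<le> K * indicator {0..t} x"
    and lim: "\<And>x. (\<lambda>n. g n x) \<longlonglongrightarrow> h x"
  shows "(\<lambda>n. difference_integral P N (g n)) \<longlonglongrightarrow> difference_integral P N h"
proof -
  have h: "h \<in> borel_measurable borel"
    using lim g(1) by (rule borel_measurable_LIMSEQ_real)
  have "(\<lambda>n. integral\<^sup>L M (g n)) \<longlonglongrightarrow> integral\<^sup>L M h" if M: "radon_measure_halfline M" for M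
    by (rule integral_dominated_convergence[OF radon_measurable[OF M h] radon_measurable[OF M g(1)]
          radon_integrable_indicator[OF M, of K t]])
      (use lim g(2) in auto)
  then show ?thesis
    unfolding difference_integral_def using represents_radon by (intro tendsto_diff) auto
qed

end

lemma difference_integral_unique:
  assumes rep: "represents_dG G P N" "represents_dG G P' N'"
    and f: "bounded_borel_on {0..t} f" and t: "0 < t"
  shows "difference_integral P N f = difference_integral P' N' f"
  using f t
proof (induction f rule: bounded_borel_on_induct)
  case (initial s)
  then show ?case using rep by (simp add: difference_integral_initial)
next
  case (scale c g)
  then show ?case by (simp add: difference_integral_scale)
next
  case (add g h)
  then show ?case
    using difference_integral_add[OF rep(1) add(1,2)] difference_integral_add[OF rep(2) add(1,2)]
    by simp
next
  case (limit g h K)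
  show ?case
    using difference_integral_tendsto[OF rep(1) limit.hyps]
      difference_integral_tendsto[OF rep(2) limit.hyps] limit.IH
    by (auto intro: LIMSEQ_unique)
qed

lemma dG_integral_eq_difference_integral:
  assumes rep: "represents_dG G P N" and t: "0 < t"
    and f: "bounded_borel_on {0..t} (\<lambda>x. indicator {0..t} x * f x)"
  shows "dG_integral G {0..t} f = difference_integral P N (\<lambda>x. indicator {0..t} x * f x)"
  unfolding dG_integral_def
proof (rule the_equality, goal_cases)
  case 1
  show ?case
    using rep represents_radon[OF rep, THEN radon_integrable, OF f]
    by (intro exI[of _ P] exI[of _ N])
      (simp add: set_integrable_def set_lebesgue_integral_def difference_integral_def)
next
  case (2 I)
  then obtain P' N' where rep': "represents_dG G P' N'"
    and I: "I = difference_integral P' N' (\<lambda>x. indicator {0..t} x * f x)"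
    by (auto simp: set_lebesgue_integral_def difference_integral_def)
  then show ?case
    using difference_integral_unique[OF rep' rep f t] by simp
qed

section \<open>The Jordan decomposition\<close>

text \<open>
  The Lebesgue--Stieltjes measure of \<open>g\<close> on \<open>(-1, \<infinity>)\<close> is pushed forward under \<open>x \<mapsto> max 0 x\<close>. The
  map collects all mass of \<open>(-1, 0]\<close> at \<open>0\<close>, so the increment \<open>g 0 - g (-1)\<close>
  becomes a point mass there.
\<close>

lemma radon_measure_of_distribution_function:
  fixes g :: "real \<Rightarrow> real"
  assumes mono: "mono g" and right: "\<And>x. continuous (at_right x) g"
  shows "\<exists>P. radon_measure_halfline P \<and> (\<forall>T\<ge>0. measure P {0..T} = g T - g (-1))"
proof -
  define R where "R = restrict_space (interval_measure g) {-1<..}"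
  define P where "P = distr R (restrict_space borel {0..}) (max 0)"
  have m[measurable]: "max 0 \<in> R \<rightarrow>\<^sub>M restrict_space borel {0::real..}"
    unfolding R_def by (intro measurable_restrict_space1 measurable_restrict_space2) auto
  have em: "emeasure P {0..T} = ennreal (g T - g (-1))" if "0 \<le> T" for T
  proof -
    have "{0..T} \<in> sets (restrict_space borel {0..})"
      by (auto simp: sets_restrict_space image_iff intro!: bexI[of _ "{0..T}"])
    then have "emeasure P {0..T} = emeasure R (max 0 -` {0..T} \<inter> space R)"
      unfolding P_def by (rule emeasure_distr[OF m])
    also have "max 0 -` {0..T} \<inter> space R = {-1<..T}"
      using that by (auto simp: R_def space_restrict_space)
    also have "emeasure R {-1<..T} = emeasure (interval_measure g) {-1<..T}"
      unfolding R_def by (rule emeasure_restrict_space) auto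
    also have "\<dots> = ennreal (g T - g (-1))"
      using that monoD[OF mono] by (intro emeasure_interval_measure_Ioc right) auto
    finally show ?thesis .
  qed
  have "emeasure P {0..T} < \<infinity>" for T
    by (cases "0 \<le> T") (simp_all add: em)
  then have "radon_measure_halfline P"
    by (simp add: radon_measure_halfline_def P_def)
  moreover have "measure P {0..T} = g T - g (-1)" if "0 \<le> T" for T
    using em[OF that] monoD[OF mono, of "-1" T] that by (simp add: measure_def)
  ultimately show ?thesis by blast
qed

text \<open>
  The right limits \<open>g x = p(x+)\<close>. Passing to them makes it possible to decompose a right-continuous function
  of bounded variation without proving that its variation is right-continuous.
\<close>

lemma mono_right_limit:
  fixes p :: "real \<Rightarrow> real"
  assumes "mono p"
  obtains g where "mono g" "\<And>x. continuous (at_right x) g" "\<And>x. (p \<longlongrightarrow> g x) (at_right x)"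
    "\<And>x y. x < y \<Longrightarrow> g x \<le> p y" "\<And>x. p x \<le> g x"
proof -
  define g where "g x = Inf (p ` {x<..})" for x
  have bdd: "bdd_below (p ` {x<..})" for x
    using monoD[OF assms] by (intro bdd_belowI[of _ "p x"]) auto
  have upper: "g x \<le> p y" if "x < y" for x y
    unfolding g_def using bdd that by (intro cInf_lower) auto
  have lower: "p x \<le> g x" for x
    unfolding g_def using monoD[OF assms] by (intro cInf_greatest) auto
  have close: "\<exists>y>x. p y < g x + e" if "0 < e" for x e
    using cInf_lessD[of "p ` {x<..}" "g x + e"] that by (auto simp: g_def)
  have mono_g: "mono g"
    unfolding g_def by (intro monoI cInf_superset_mono bdd image_mono) auto
  have p_lim: "(p \<longlongrightarrow> g x) (at_right x)" for x
  proof (rule order_tendstoI)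
    fix a assume a: "a < g x"
    show "\<forall>\<^sub>F y in at_right x. a < p y"
      using eventually_at_right_less[of x]
      by eventually_elim (rule less_le_trans[OF a upper])
  next
    fix a assume "g x < a"
    then obtain y where "x < y" "p y < a" using close[of "a - g x" x] by auto
    then show "\<forall>\<^sub>F z in at_right x. p z < a"
      unfolding eventually_at_right[OF \<open>x < y\<close>] using monoD[OF assms]
      by (meson less_imp_le le_less_trans)
  qed
  have g_lim: "continuous (at_right x) g" for x
  proof (subst continuous_at_right_real_increasing)
    show "g y \<le> g z" if "y \<le> z" for y z using mono_g that by (rule monoD)
    show "\<forall>e>0. \<exists>d>0. g (x + d) - g x < e"
    proof safe
      fix e :: real assume "0 < e"
      then obtain y where y: "x < y" "p y < g x + e" using close by blast
      have "g (x + (y - x) / 2) \<le> p y" using y by (intro upper) (simp add: field_simps)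
      with y show "\<exists>d>0. g (x + d) - g x < e"
        by (intro exI[of _ "(y - x) / 2"]) auto
    qed
  qed
  show thesis by (rule that[OF mono_g g_lim p_lim upper lower])
qed

definition variation_sums :: "(real \<Rightarrow> real) \<Rightarrow> real \<Rightarrow> real set" where
  "variation_sums G T = {\<Sum>i<n. \<bar>G (x (Suc i)) - G (x i)\<bar> | n (x :: nat \<Rightarrow> real).
     (\<forall>i\<le>n. x i \<in> {0..T}) \<and> (\<forall>i<n. x i \<le> x (Suc i))}"

lemma variation_sums_bdd_above:
  "bounded_variation_on 0 T G \<longleftrightarrow> bdd_above (variation_sums G T)"
  unfolding bounded_variation_on_def variation_sums_def bdd_above_def by blast

lemma variation_sums_zero:
  assumes "0 \<le> T"
  shows "0 \<in> variation_sums G T"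
  unfolding variation_sums_def using assms
  by (intro CollectI exI[of _ 0] exI[of _ "\<lambda>_. 0"]) auto

text \<open>
  The points \<open>a\<close> and \<open>b\<close> are appended to the subdivision of \<open>[0,a]\<close>. Hence the variation over \<open>[0,b]\<close>
  exceeds that over \<open>[0,a]\<close> by at least \<open>\<bar>G b - G a\<bar>\<close>, which makes both the variation and its
  difference with \<open>G\<close> monotone.
\<close>

lemma variation_sums_extend:
  assumes "v \<in> variation_sums G a" "a \<le> b"
  shows "\<exists>w\<in>variation_sums G b. v + \<bar>G b - G a\<bar> \<le> w"
proof -
  obtain n x where x: "\<forall>i\<le>n. x i \<in> {0..a}" "\<forall>i<n. x i \<le> x (Suc i)"
    and v: "v = (\<Sum>i<n. \<bar>G (x (Suc i)) - G (x i)\<bar>)"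
    using assms(1) by (auto simp: variation_sums_def)
  define y where "y i = (if i \<le> n then x i else if i = Suc n then a else b)" for i
  have "(\<Sum>i<n. \<bar>G (y (Suc i)) - G (y i)\<bar>) = v"
    unfolding v by (intro sum.cong) (auto simp: y_def)
  then have "v + \<bar>G b - G a\<bar> \<le> (\<Sum>i<Suc (Suc n). \<bar>G (y (Suc i)) - G (y i)\<bar>)"
    by (simp add: y_def)
  moreover have "(\<Sum>i<Suc (Suc n). \<bar>G (y (Suc i)) - G (y i)\<bar>) \<in> variation_sums G b"
    unfolding variation_sums_def using x assms(2)
    by (intro CollectI exI[of _ "Suc (Suc n)"] exI[of _ y])
      (force simp: y_def less_Suc_eq le_Suc_eq)
  ultimately show ?thesis by blast
qed

lemma bounded_variation_difference_of_mono:
  assumes bv: "\<And>T. 0 \<le> T \<Longrightarrow> bounded_variation_on 0 T G" and G0: "G 0 = 0"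
  obtains p n :: "real \<Rightarrow> real" where "mono p" "mono n"
    "\<And>x. x < 0 \<Longrightarrow> p x = 0" "\<And>x. x < 0 \<Longrightarrow> n x = 0" "\<And>x. 0 \<le> x \<Longrightarrow> p x - n x = G x"
proof -
  define V where "V x = Sup (variation_sums G x)" for x
  have bdd: "bdd_above (variation_sums G x)" if "0 \<le> x" for x
    using bv[OF that] by (simp add: variation_sums_bdd_above)
  have step: "V a + \<bar>G b - G a\<bar> \<le> V b" if ab: "0 \<le> a" "a \<le> b" for a b
  proof -
    have "V a \<le> V b - \<bar>G b - G a\<bar>"
      unfolding V_def[of a]
    proof (rule cSup_least)
      show "variation_sums G a \<noteq> {}" using variation_sums_zero[OF ab(1)] by blast
      fix v assume "v \<in> variation_sums G a"
      from variation_sums_extend[OF this ab(2)] obtain w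
        where w: "w \<in> variation_sums G b" "v + \<bar>G b - G a\<bar> \<le> w" by blast
      have "w \<le> V b" unfolding V_def using w(1) bdd ab by (intro cSup_upper) auto
      with w(2) show "v \<le> V b - \<bar>G b - G a\<bar>" by linarith
    qed
    then show ?thesis by simp
  qed
  have V0: "0 \<le> V 0"
    unfolding V_def using variation_sums_zero bdd by (intro cSup_upper) auto
  have V: "\<bar>G x\<bar> \<le> V x" if "0 \<le> x" for x using step[of 0 x] V0 G0 that by simp
  show thesis
  proof (rule that[of "\<lambda>x. if x < 0 then 0 else V x" "\<lambda>x. if x < 0 then 0 else V x - G x"])
    show "mono (\<lambda>x. if x < 0 then 0 else V x)"
    proof (rule monoI)
      fix x y :: real assume "x \<le> y"
      then show "(if x < 0 then 0 else V x) \<le> (if y < 0 then 0 else V y)"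
        using step[of x y] V[of y] by auto
    qed
    show "mono (\<lambda>x. if x < 0 then 0 else V x - G x)"
    proof (rule monoI)
      fix x y :: real assume "x \<le> y"
      then show "(if x < 0 then 0 else V x - G x) \<le> (if y < 0 then 0 else V y - G y)"
        using step[of x y] V[of y] by auto
    qed
  qed auto
qed

text \<open>
  Write \<open>G = p - n\<close> on \<open>[0,\<infinity>)\<close> with monotone \<open>p\<close> and \<open>n\<close> that vanish on the negative half-line. At
  \<open>x > 0\<close> the function \<open>G\<close> equals its right limit, so \<open>G x = p(x+) - n(x+)\<close>, and the two right-limit
  functions are distribution functions of positive measures.
\<close>

lemma NBV_loc_represented:
  assumes "G \<in> NBV_loc"
  shows "\<exists>P N. represents_dG G P N"
proof -
  have G: "G 0 = 0" "\<And>x. 0 < x \<Longrightarrow> continuous (at_right x) G"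
    "\<And>T. 0 \<le> T \<Longrightarrow> bounded_variation_on 0 T G"
    using assms by (auto simp: NBV_loc_def)
  obtain p n where pn: "mono p" "mono n" "\<And>x. x < 0 \<Longrightarrow> p x = 0" "\<And>x. x < 0 \<Longrightarrow> n x = 0"
    and diff: "\<And>x. 0 \<le> x \<Longrightarrow> p x - n x = G x"
    using bounded_variation_difference_of_mono[OF G(3,1)] by blast
  obtain p' where p': "mono p'" "\<And>x. continuous (at_right x) p'" "\<And>x. (p \<longlongrightarrow> p' x) (at_right x)"
    "\<And>x y. x < y \<Longrightarrow> p' x \<le> p y" "\<And>x. p x \<le> p' x"
    using mono_right_limit[OF pn(1)] by blast
  obtain n' where n': "mono n'" "\<And>x. continuous (at_right x) n'" "\<And>x. (n \<longlongrightarrow> n' x) (at_right x)"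
    "\<And>x y. x < y \<Longrightarrow> n' x \<le> n y" "\<And>x. n x \<le> n' x"
    using mono_right_limit[OF pn(2)] by blast
  have zero: "p' (-1) = 0" "n' (-1) = 0"
    using p'(4)[of "-1" "-1/2"] p'(5)[of "-1"] n'(4)[of "-1" "-1/2"] n'(5)[of "-1"] pn(3,4)
    by (auto intro: antisym)
  obtain P N where PN: "radon_measure_halfline P" "radon_measure_halfline N"
    "\<And>T. 0 \<le> T \<Longrightarrow> measure P {0..T} = p' T" "\<And>T. 0 \<le> T \<Longrightarrow> measure N {0..T} = n' T"
    using radon_measure_of_distribution_function[OF p'(1,2)]
      radon_measure_of_distribution_function[OF n'(1,2)] zero by force
  have "p' x - n' x = G x" if x: "0 < x" for x
  proof (rule tendsto_unique[of "at_right x"])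
    show "((\<lambda>y. p y - n y) \<longlongrightarrow> p' x - n' x) (at_right x)"
      by (intro tendsto_diff p' n')
    have "(G \<longlongrightarrow> G x) (at_right x)"
      using G(2)[OF x] by (simp add: continuous_within)
    moreover have "\<forall>\<^sub>F y in at_right x. G y = p y - n y"
      using x diff by (auto simp: eventually_at_filter)
    ultimately show "((\<lambda>y. p y - n y) \<longlongrightarrow> G x) (at_right x)"
      by (rule Lim_transform_eventually)
  qed simp
  then show ?thesis
    using PN by (intro exI[of _ P] exI[of _ N]) (simp add: represents_dG_def)
qed

section \<open>Sequential completeness\<close>

text \<open>
  Each neighbourhood of zero in the weak topology is built from subbasic ones by finite intersections and
  unions, so it is enough to test the Cauchy condition against each functional separately.
\<close>

lemma weakly_CauchyI:
  assumes B: "bilinear B" and X: "\<And>d. Cauchy (\<lambda>n. B d (X n))"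
  shows "weakly_Cauchy B X"
  unfolding weakly_Cauchy_def
proof (intro allI impI, elim conjE)
  fix U assume "openin (weak_topology B) U" "0 \<in> U"
  then have "generate_topology_on {B d -` U | d U. open U} U"
    unfolding weak_topology_def by (elim openin_topology_generated_by)
  then show "\<exists>N. \<forall>m\<ge>N. \<forall>n\<ge>N. X m - X n \<in> U"
    using \<open>0 \<in> U\<close>
  proof induction
    case (Int U U')
    then obtain N N' where "\<forall>m\<ge>N. \<forall>n\<ge>N. X m - X n \<in> U" "\<forall>m\<ge>N'. \<forall>n\<ge>N'. X m - X n \<in> U'"
      by blast
    then show ?case by (intro exI[of _ "max N N'"]) auto
  next
    case (UN K)
    then obtain U where "U \<in> K" "0 \<in> U" by blast
    then show ?case using UN.IH[of U] by blast
  next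
    case (Basis U)
    then obtain d V where U: "U = B d -` V" "open V" by blast
    then have "0 \<in> V" using Basis B by (simp add: bilinear_rzero)
    then obtain e where e: "0 < e" "ball 0 e \<subseteq> V"
      using U(2) openE by blast
    obtain N where "\<forall>m\<ge>N. \<forall>n\<ge>N. dist (B d (X m)) (B d (X n)) < e"
      using X[of d] e(1) by (auto simp: Cauchy_def)
    moreover have "B d (X m - X n) = B d (X m) - B d (X n)" for m n
      using B by (simp add: bilinear_rsub)
    ultimately have "\<forall>m\<ge>N. \<forall>n\<ge>N. B d (X m - X n) \<in> ball 0 e"
      by (simp add: dist_real_def abs_minus_commute)
    then show ?case using U(1) e(2) by blast
  qed auto
qed

lemma limitin_weak_topology_imp_tendsto:
  assumes "limitin (weak_topology B) X l F"
  shows "((\<lambda>n. B d (X n)) \<longlongrightarrow> B d l) F"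
proof (rule topological_tendstoI)
  fix V assume "open V" "B d l \<in> V"
  moreover have "openin (weak_topology B) (B d -` V)"
    unfolding weak_topology_def by (rule topology_generated_by_Basis) (use \<open>open V\<close> in blast)
  ultimately show "\<forall>\<^sub>F n in F. B d (X n) \<in> V"
    using assms by (auto simp: limitin_def)
qed

lemma weakly_sequentially_complete_limit:
  assumes "bilinear B" "weakly_sequentially_complete B"
    and lim: "\<And>d. (\<lambda>n. B d (X n)) \<longlonglongrightarrow> \<phi> d"
  shows "\<exists>u. \<forall>d. \<phi> d = B d u"
proof -
  have "Cauchy (\<lambda>n. B d (X n))" for d
    using lim by (blast intro: LIMSEQ_imp_Cauchy)
  from weakly_CauchyI[OF assms(1) this] assms(2) obtain u
    where "limitin (weak_topology B) X u sequentially"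
    by (auto simp: weakly_sequentially_complete_def)
  from limitin_weak_topology_imp_tendsto[OF this] lim show ?thesis
    by (blast intro: LIMSEQ_unique)
qed

text \<open>
  The core of the argument: a weak integral whose values on the intervals \<open>[0,s]\<close> lie in \<open>Y\<close> has all its
  values in \<open>Y\<close>.
\<close>

lemma difference_integral_representable:
  assumes B: "bilinear B" and complete: "weakly_sequentially_complete B"
    and rep: "\<And>d. represents_dG (G d) (P d) (N d)"
    and vals: "\<And>s. 0 < s \<Longrightarrow> \<exists>u. \<forall>d. G d s = B d u"
    and f: "bounded_borel_on {0..t} f" and t: "0 < t"
  shows "\<exists>u. \<forall>d. difference_integral (P d) (N d) f = B d u"
  using f t
proof (induction f rule: bounded_borel_on_induct)
  case (initial s)
  then show ?case by (simp add: difference_integral_initial[OF rep] vals)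
next
  case (scale c g)
  then obtain u where "\<forall>d. difference_integral (P d) (N d) g = B d u" by blast
  then have "\<forall>d. difference_integral (P d) (N d) (\<lambda>x. c * g x) = B d (c *\<^sub>R u)"
    by (simp add: difference_integral_scale bilinear_rmul[OF B])
  then show ?case by blast
next
  case (add g h)
  then obtain u v where "\<forall>d. difference_integral (P d) (N d) g = B d u"
    "\<forall>d. difference_integral (P d) (N d) h = B d v" by blast
  then have "\<forall>d. difference_integral (P d) (N d) (\<lambda>x. g x + h x) = B d (u + v)"
    by (simp add: difference_integral_add[OF rep add(1,2)] bilinear_radd[OF B])
  then show ?case by blast
next
  case (limit g h K)
  then obtain X where X: "\<And>n d. difference_integral (P d) (N d) (g n) = B d (X n)" by metis
  have "(\<lambda>n. B d (X n)) \<longlonglongrightarrow> difference_integral (P d) (N d) h" for d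
    using difference_integral_tendsto[OF rep limit.hyps] by (simp add: X)
  then show ?case by (rule weakly_sequentially_complete_limit[OF B complete])
qed

lemma bounded_borel_on_reflected:
  assumes bdd: "bounded (F ` {0..t})" and F: "F \<in> borel_measurable (restrict_space borel {0..})"
  shows "bounded_borel_on {0..t} (\<lambda>x. indicator {0..t} x * F (t - x))"
proof -
  obtain K where K: "\<And>x. x \<in> {0..t} \<Longrightarrow> \<bar>F x\<bar> \<le> K"
    using bdd unfolding bounded_iff by fastforce
  have [measurable]: "(\<lambda>x. indicator {0..} x * F x) \<in> borel_measurable borel"
    using F by (subst (asm) borel_measurable_restrict_space_iff) auto
  have "(\<lambda>x. indicator {0..t} x * (indicator {0..} (t - x) * F (t - x))) \<in> borel_measurable borel"
    by measurable
  also have "(\<lambda>x. indicator {0..t} x * (indicator {0..} (t - x) * F (t - x))) =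
      (\<lambda>x. indicator {0..t} x * F (t - x))"
    by (auto simp: indicator_def)
  finally show ?thesis
    by (rule bounded_borel_onI[where K = K]) (use K in \<open>auto simp: indicator_def\<close>)
qed

theorem lemma8p1:
  fixes B :: "'d::banach \<Rightarrow> 'y::banach \<Rightarrow> real"
    and S :: "real \<Rightarrow> 'd \<Rightarrow> 'y \<Rightarrow> real"
    and q :: 'y
    and F :: "real \<Rightarrow> real"
  assumes "norming_dual_pair B"
    and "twin_semigroup B S"
    and "weakly_sequentially_complete B"
    and "\<And>d. orbit_from_zero S q d \<in> NBV_loc"
    and "\<And>T. bounded (F ` {0..T})"
    and "F \<in> borel_measurable (restrict_space borel {0..})"
  shows "\<forall>t>0. \<exists>u. \<forall>d. dG_integral (orbit_from_zero S q d) {0..t} (\<lambda>\<sigma>. F (t - \<sigma>)) = B d u"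
proof (intro allI impI)
  fix t :: real assume t: "0 < t"
  \<comment> \<open>The representing measures are chosen separately for each \<open>d\<close>; nothing relates them for different \<open>d\<close>.\<close>
  obtain P N where rep: "\<And>d. represents_dG (orbit_from_zero S q d) (P d) (N d)"
    using NBV_loc_represented[OF assms(4)] by metis
  have vals: "\<exists>u. \<forall>d. orbit_from_zero S q d s = B d u" if "0 < s" for s
  proof -
    have "twin_operator B (S s)" using assms(2) that by (simp add: twin_semigroup_def)
    then obtain u where "\<And>d. B d u = S s d q" unfolding twin_operator_def by blast
    then show ?thesis using that by (intro exI[of _ u]) (simp add: orbit_from_zero_def)
  qed
  have F: "bounded_borel_on {0..t} (\<lambda>\<sigma>. indicator {0..t} \<sigma> * F (t - \<sigma>))"
    using assms(5,6) by (rule bounded_borel_on_reflected)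
  have "bilinear B" using assms(1) by (simp add: norming_dual_pair_def)
  from difference_integral_representable[OF this assms(3) rep vals F t]
  show "\<exists>u. \<forall>d. dG_integral (orbit_from_zero S q d) {0..t} (\<lambda>\<sigma>. F (t - \<sigma>)) = B d u"
    by (simp add: dG_integral_eq_difference_integral[OF rep t F])
qed

end
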